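(* In a switching-converter system of the form described in the context, saddle-node bifurcation (of the $T$-periodic steady-state solution $x^0(t)$ with switching instant $d$) occurs when $$\dot{y}^0(d^-) - C\left(I - e^{-A_2(T-d)} e^{-A_1 d}\right)^{-1}\left(\dot{x}^0(d^-) - \dot{x}^0(d^+)\right) = \dot{h}(d).$$
   Context: Model. $A_1,A_2\in\mathbf R^{N\times N}$, $B_1,B_2\in\mathbf R^{N\times 2}$, $C\in\mathbf R^{1\times N}$, $D\in\mathbf R^{1\times 2}$ are constant matrices, where $N$ is the system dimension, and $u=(v_s,v_r)'$ consists of the source voltage $v_s$ and the control (reference) signal $v_r$. Within a clock period $T$, the dynamics is switched between two stages, $S_1$: $\dot x=A_1x+B_1u$, followed by $S_2$: $\dot x=A_2x+B_2u$. Switching occurs when the ramp signal $h(t)$ intersects the compensator output $y:=Cx+Du\in\mathbf R$. Steady state. $x^0(t)$ is a $T$-periodic solution, in stage $S_1$ from $0$ to $d$ and in stage $S_2$ from $d$ to $T$, so that $x^0(d)=e^{A_1d}x^0(0)+\int_0^d e^{A_1\sigma}d\sigma\,B_1u$, $x^0(0)=e^{A_2(T-d)}x^0(d)+\int_0^{T-d}e^{A_2\sigma}d\sigma\,B_2u$, and $Cx^0(d)+Du=h(d)$. Write $y^0(t)=Cx^0(t)+Du$, $\dot x^0(d^-)=A_1x^0(d)+B_1u$, $\dot x^0(d^+)=A_2x^0(d)+B_2u$, $\dot y^0(d^-)=C\dot x^0(d^-)$; $\dot h(d)$ is the ramp slope at $t=d$. Linearization. With $x_n$ the state sampled at $t=nT$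 and $\hat x_n=x_n-x^0(0)$, the linearized sampled-data dynamics is $\hat x_{n+1}=\Phi\hat x_n$ with $$\Phi=e^{A_2(T-d)}\left(I-\frac{(\dot x^0(d^-)-\dot x^0(d^+))C}{\dot y^0(d^-)-\dot h(d)}\right)e^{A_1d}.$$ Saddle-node bifurcation occurs when one eigenvalue of $\Phi$ is $1$, and then $\det[I-\Phi]=0$ (other bifurcations, such as pitchfork or transcritical, also have one eigenvalue of $\Phi$ at $1$). *)

theory Defs
  imports "HOL-Analysis.Analysis"
begin

(* Multiplication and power on the vec type are componentwise, so the powers in the
   exponential series are iterated matrix products and the library's exp does not apply. *)
primrec mat_power :: "real^'n^'n \<Rightarrow> nat \<Rightarrow> real^'n^'n" where
  "mat_power A 0 = mat 1"
| "mat_power A (Suc k) = A ** mat_power A k"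

definition mat_exp :: "real^'n^'n \<Rightarrow> real^'n^'n" where
  "mat_exp A = (\<Sum>k. (1 / fact k) *\<^sub>R mat_power A k)"

definition stage_field :: "real^'n^'n \<Rightarrow> real^2^'n \<Rightarrow> real^2 \<Rightarrow> real^'n \<Rightarrow> real^'n" where
  "stage_field A B u x = A *v x + B *v u"

definition compensator_output :: "real^'n^1 \<Rightarrow> real^2^1 \<Rightarrow> real^2 \<Rightarrow> real^'n \<Rightarrow> real" where
  "compensator_output C D u x = (C *v x + D *v u) $ 1"

(* By variation of constants the two differential equations give
   x0 d = e^(A1 d) x0 0 + (integral over 0..d of e^(A1 s) ds) B1 u   and
   x0 T = e^(A2 (T - d)) x0 d + (integral over 0..T-d of e^(A2 s) ds) B2 u,
   where x0 T = x0 0 by periodicity. *)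
definition periodic_steady_state ::
  "real^'n^'n \<Rightarrow> real^'n^'n \<Rightarrow> real^2^'n \<Rightarrow> real^2^'n \<Rightarrow> real^'n^1 \<Rightarrow> real^2^1 \<Rightarrow> real^2 \<Rightarrow>
   (real \<Rightarrow> real) \<Rightarrow> real \<Rightarrow> real \<Rightarrow> (real \<Rightarrow> real^'n) \<Rightarrow> bool" where
  "periodic_steady_state A1 A2 B1 B2 C D u h T d x0 \<longleftrightarrow>
     0 < d \<and> d < T \<and>
     (\<forall>t. x0 (t + T) = x0 t) \<and>
     (\<forall>t\<in>{0..d}. (x0 has_vector_derivative stage_field A1 B1 u (x0 t)) (at t within {0..d})) \<and>
     (\<forall>t\<in>{d..T}. (x0 has_vector_derivative stage_field A2 B2 u (x0 t)) (at t within {d..T})) \<and>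
     compensator_output C D u (x0 d) = h d"

(* Jacobian of the map taking the state sampled at one clock instant to the next.
   The arguments xm and xp stand for the one-sided derivatives of the state just before
   and just after switching, ym for the one-sided output slope just before switching, and
   hs for the ramp slope. It is meaningful only for ym different from hs. *)
definition sampled_jacobian ::
  "real^'n^'n \<Rightarrow> real^'n^'n \<Rightarrow> real^'n^1 \<Rightarrow> real \<Rightarrow> real \<Rightarrow> real^'n \<Rightarrow> real^'n \<Rightarrow> real \<Rightarrow> real \<Rightarrow>
   real^'n^'n" where
  "sampled_jacobian A1 A2 C T d xm xp ym hs =
     mat_exp ((T - d) *\<^sub>R A2) **
     (mat 1 - (1 / (ym - hs)) *\<^sub>R (columnvector (xm - xp) ** C)) **
     mat_exp (d *\<^sub>R A1)"

definition mat_eigenvalue :: "real^'n^'n \<Rightarrow> real \<Rightarrow> bool" where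
  "mat_eigenvalue M c \<longleftrightarrow> (\<exists>v. v \<noteq> 0 \<and> M *v v = c *\<^sub>R v)"

(* The linearized criterion: the sampled-data Jacobian has 1 as an eigenvalue. It does not
   separate saddle-node from transcritical or pitchfork bifurcations. *)
definition saddle_node_criterion :: "real^'n^'n \<Rightarrow> bool" where
  "saddle_node_criterion M \<longleftrightarrow> mat_eigenvalue M 1"

end

theory Submission
  imports Defs
begin

(* The matrix exponentials are invertible, so with w = e^(A1 d) v the equation Phi v = v reads
   (I - e^(-A2(T-d)) e^(-A1 d)) w = (C w / (ym - h'(d))) (xm - xp).  Hence w must be a multiple of
   M^(-1) (xm - xp), where M is the matrix on the left, and applying C gives the criterion. *)

text \<open>This lets the scalar exponential series dominate the matrix series entry by entry. Each
  further product sums \<open>CARD('n)\<close> terms and each entry of \<open>A\<close> is at most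
  \<open>norm A\<close>, so the bound grows by the product of the two.\<close>

lemma mat_power_entry_bound:
  fixes A :: "real^'n^'n"
  shows "\<bar>mat_power A k $ i $ j\<bar> \<le> (real CARD('n) * norm A) ^ k"
\<comment> \<open>The row index is generalized because row \<open>i\<close> of the next power draws
  on all rows \<open>l\<close> of the previous one.\<close>
proof (induction k arbitrary: i)
  case 0
  then show ?case by (simp add: mat_def)
next
  case (Suc k)
  have entry: "\<bar>A $ i $ l\<bar> \<le> norm A" for l
    using component_le_norm_cart[of "A $ i" l] Finite_Cartesian_Product.norm_nth_le[of A i] by linarith
  have "\<bar>mat_power A (Suc k) $ i $ j\<bar> \<le> (\<Sum>l\<in>UNIV. \<bar>A $ i $ l * mat_power A k $ l $ j\<bar>)"
    by (simp add: matrix_matrix_mult_def)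
  also have "\<dots> \<le> (\<Sum>l\<in>(UNIV::'n set). norm A * (real CARD('n) * norm A) ^ k)"
    unfolding abs_mult by (intro sum_mono mult_mono entry Suc.IH) auto
  also have "\<dots> = (real CARD('n) * norm A) ^ Suc k" by simp
  finally show ?case .
qed

text \<open>Absolute convergence is what the Cauchy product of two such series requires.\<close>

lemma summable_mat_exp_entry:
  fixes A :: "real^'n^'n"
  shows "summable (\<lambda>k. \<bar>mat_power A k $ i $ j / fact k\<bar>)"
proof (rule summable_comparison_test'[where N = 0])
  show "summable (\<lambda>k. inverse (fact k) * (real CARD('n) * norm A) ^ k)"
    by (rule summable_exp)
  show "norm \<bar>mat_power A k $ i $ j / fact k\<bar> \<le> inverse (fact k) * (real CARD('n) * norm A) ^ k" for k
    using mat_power_entry_bound[of A k i j] by (simp add: field_simps)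
qed

text \<open>Convergence of matrices is entrywise, so the convergent scalar series assemble into the
  limit of the matrix series. Questions about \<open>mat_exp\<close> thus reduce to real
  series.\<close>

lemma mat_exp_entry: "mat_exp A $ i $ j = (\<Sum>k. mat_power A k $ i $ j / fact k)"
proof -
  have "(\<lambda>k. (1 / fact k) *\<^sub>R mat_power A k) sums (\<chi> i j. \<Sum>k. mat_power A k $ i $ j / fact k)"
    unfolding sums_def
  proof (intro vec_tendstoI)
    fix i j
    have "(\<lambda>k. mat_power A k $ i $ j / fact k) sums (\<Sum>k. mat_power A k $ i $ j / fact k)"
      by (rule summable_sums[OF summable_rabs_cancel[OF summable_mat_exp_entry]])
    then show "(\<lambda>n. (\<Sum>k<n. (1 / fact k) *\<^sub>R mat_power A k) $ i $ j)
      \<longlonglongrightarrow> (\<chi> i j. \<Sum>k. mat_power A k $ i $ j / fact k) $ i $ j"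
      by (simp add: sums_def)
  qed
  then show ?thesis by (simp add: mat_exp_def sums_iff)
qed

lemma mat_power_add: "mat_power A (m + n) = mat_power A m ** mat_power A n"
  by (induction m) (simp_all add: matrix_mul_assoc)

lemma mat_power_scaleR: "mat_power (c *\<^sub>R A) n = c ^ n *\<^sub>R mat_power A n"
  by (induction n) (simp_all add: vec_eq_iff matrix_matrix_mult_def sum_distrib_left mult_ac)

text \<open>Multiples of one matrix commute, so the scalar addition law carries over: form the
  Cauchy product in each entry and compare terms of equal degree.\<close>

lemma mat_exp_add_scaleR:
  fixes A :: "real^'n^'n"
  shows "mat_exp (s *\<^sub>R A) ** mat_exp (t *\<^sub>R A) = mat_exp ((s + t) *\<^sub>R A)"
proof -
  let ?a = "\<lambda>c k i j. mat_power (c *\<^sub>R A) k $ i $ j / fact k"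
  \<comment> \<open>In degree \<open>n\<close> every product of powers collapses to
    \<open>mat_power A n\<close>. The remaining scalar coefficients sum by the binomial
    theorem.\<close>
  have cauchy: "(\<Sum>l\<in>UNIV. \<Sum>p\<le>n. ?a s p i l * ?a t (n - p) l j) = ?a (s + t) n i j" for n i j
  proof -
    have "(\<Sum>l\<in>UNIV. \<Sum>p\<le>n. ?a s p i l * ?a t (n - p) l j)
      = (\<Sum>p\<le>n. \<Sum>l\<in>UNIV. ?a s p i l * ?a t (n - p) l j)"
      by (rule sum.swap)
    also have "\<dots> = (\<Sum>p\<le>n. (s ^ p /\<^sub>R fact p) * (t ^ (n - p) /\<^sub>R fact (n - p)) * mat_power A n $ i $ j)"
    proof (rule sum.cong[OF refl])
      fix p assume "p \<in> {..n}"
      then have "mat_power A n $ i $ j = (\<Sum>l\<in>UNIV. mat_power A p $ i $ l * mat_power A (n - p) $ l $ j)"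
        using mat_power_add[of A p "n - p"] by (simp add: matrix_matrix_mult_def)
      then show "(\<Sum>l\<in>UNIV. ?a s p i l * ?a t (n - p) l j)
          = (s ^ p /\<^sub>R fact p) * (t ^ (n - p) /\<^sub>R fact (n - p)) * mat_power A n $ i $ j"
        by (simp add: mat_power_scaleR sum_distrib_left field_simps)
    qed
    also have "\<dots> = ((s + t) ^ n /\<^sub>R fact n) * mat_power A n $ i $ j"
      by (simp only: exp_series_add_commuting[OF mult.commute] sum_distrib_right)
    also have "\<dots> = ?a (s + t) n i j"
      by (simp add: mat_power_scaleR divide_inverse)
    finally show ?thesis .
  qed
  have "(mat_exp (s *\<^sub>R A) ** mat_exp (t *\<^sub>R A)) $ i $ j = mat_exp ((s + t) *\<^sub>R A) $ i $ j" for i j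
  proof -
    have "(\<lambda>n. \<Sum>l\<in>UNIV. \<Sum>p\<le>n. ?a s p i l * ?a t (n - p) l j)
      sums (\<Sum>l\<in>UNIV. (\<Sum>k. ?a s k i l) * (\<Sum>k. ?a t k l j))"
      by (intro sums_sum Cauchy_product_sums) (simp_all add: summable_mat_exp_entry del: abs_divide)
    then have "(\<Sum>n. ?a (s + t) n i j) = (\<Sum>l\<in>UNIV. (\<Sum>k. ?a s k i l) * (\<Sum>k. ?a t k l j))"
      unfolding cauchy by (rule sums_unique[symmetric])
    then show ?thesis
      by (simp add: matrix_matrix_mult_def mat_exp_entry)
  qed
  then show ?thesis by (simp add: vec_eq_iff)
qed

lemma mat_exp_0: "mat_exp 0 = mat 1"
proof -
  have "mat_power 0 k = 0" if "k \<noteq> 0" for k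
    using that by (cases k) simp_all
  then have "mat_exp 0 = (\<Sum>k\<in>{0}. (1 / fact k) *\<^sub>R mat_power 0 k)"
    unfolding mat_exp_def by (intro suminf_finite) auto
  then show ?thesis by simp
qed

lemma mat_exp_minus_right: "mat_exp A ** mat_exp (- A) = mat 1"
  using mat_exp_add_scaleR[of 1 A "-1"] by (simp add: mat_exp_0)

lemma mat_exp_minus_left: "mat_exp (- A) ** mat_exp A = mat 1"
  using mat_exp_minus_right[of "- A"] by simp

lemma invertible_matrix_vector_eq_iff:
  fixes E F :: "real^'n^'n"
  assumes "E ** F = mat 1" "F ** E = mat 1"
  shows "E *v x = y \<longleftrightarrow> x = F *v y"
  using assms by (metis matrix_vector_mul_assoc matrix_vector_mul_lid)

lemma matrix_inv_inverse:
  assumes "invertible A"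
  shows "A ** matrix_inv A = mat 1" "matrix_inv A ** A = mat 1"
  using someI_ex[OF assms[unfolded invertible_def]] unfolding matrix_inv_def by blast+

text \<open>With \<open>y = C *v w\<close> this exhibits the correction term of the Jacobian as the
  rank-one map sending \<open>w\<close> to a multiple of \<open>b\<close>.\<close>

lemma columnvector_mult_vector: "columnvector b *v (y :: real^1) = y $ 1 *\<^sub>R (b :: real^'n)"
  by (simp add: vec_eq_iff matrix_vector_mult_def columnvector_def sum_1 mult.commute)

text \<open>Inverting \<open>M\<close> forces \<open>w\<close> onto the line through
  \<open>m = matrix_inv M *v b\<close>. Its coefficient itself depends on \<open>C *v w\<close>, and
  consistency of the two is the scalar condition.\<close>

lemma rank_one_eigen_iff:
  fixes M :: "real^'n^'n" and b :: "real^'n" and C :: "real^'n^1"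
  assumes "invertible M" "k \<noteq> 0"
  shows "(\<exists>w. w \<noteq> 0 \<and> M *v w = (k * (C *v w) $ 1) *\<^sub>R b) \<longleftrightarrow> k * (C *v (matrix_inv M *v b)) $ 1 = 1"
proof -
  have "M *v w = (k * (C *v w) $ 1) *\<^sub>R b \<longleftrightarrow> w = (k * (C *v w) $ 1) *\<^sub>R (matrix_inv M *v b)" for w
    using invertible_matrix_vector_eq_iff[of M "matrix_inv M"] matrix_inv_inverse[OF assms(1)]
    by (simp add: matrix_vector_mult_scaleR)
  moreover have "(\<exists>w. w \<noteq> 0 \<and> w = (k * (C *v w) $ 1) *\<^sub>R m) \<longleftrightarrow> k * (C *v m) $ 1 = 1" for m
  proof
    assume "\<exists>w. w \<noteq> 0 \<and> w = (k * (C *v w) $ 1) *\<^sub>R m"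
    then obtain w where w: "w \<noteq> 0" "w = (k * (C *v w) $ 1) *\<^sub>R m" by blast
    \<comment> \<open>Otherwise the equation would give \<open>w = 0\<close>. This permits
      cancelling the factor after \<open>C\<close> is applied to both sides.\<close>
    then have "(C *v w) $ 1 \<noteq> 0" by auto
    moreover have "(C *v w) $ 1 = (k * (C *v w) $ 1) * (C *v m) $ 1"
      by (subst w(2)) (simp only: matrix_vector_mult_scaleR vector_scaleR_component real_scaleR_def)
    ultimately show "k * (C *v m) $ 1 = 1" by (simp add: field_simps)
  next
    assume "k * (C *v m) $ 1 = 1"
    then show "\<exists>w. w \<noteq> 0 \<and> w = (k * (C *v w) $ 1) *\<^sub>R m"
      \<comment> \<open>The vector \<open>m\<close> solves the equation with coefficient 1, and it
        is nonzero because \<open>C *v m\<close> is.\<close>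
      by (intro exI[of _ m]) auto
  qed
  ultimately show ?thesis by simp
qed

theorem theorem1:
  fixes A1 A2 :: "real^'n^'n" and B1 B2 :: "real^2^'n"
    and C :: "real^'n^1" and D :: "real^2^1"
    and u :: "real^2" and h :: "real \<Rightarrow> real" and T d :: real
    and x0 :: "real \<Rightarrow> real^'n"
    and xm xp :: "real^'n" and ym :: real
  assumes steady: "periodic_steady_state A1 A2 B1 B2 C D u h T d x0"
    and ramp: "h differentiable (at d)"
    and xm: "xm = stage_field A1 B1 u (x0 d)"
    and xp: "xp = stage_field A2 B2 u (x0 d)"
    and ym: "ym = (C *v xm) $ 1"
    and transversal: "ym \<noteq> deriv h d"
    and inv: "invertible (mat 1 - mat_exp (- ((T - d) *\<^sub>R A2)) ** mat_exp (- (d *\<^sub>R A1)))"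
  shows "saddle_node_criterion (sampled_jacobian A1 A2 C T d xm xp ym (deriv h d)) \<longleftrightarrow>
    ym - (C *v (matrix_inv (mat 1 - mat_exp (- ((T - d) *\<^sub>R A2)) ** mat_exp (- (d *\<^sub>R A1)))
             *v (xm - xp))) $ 1 = deriv h d"
proof -
  define E1 F1 E2 F2 where "E1 = mat_exp (d *\<^sub>R A1)" and "F1 = mat_exp (- (d *\<^sub>R A1))"
    and "E2 = mat_exp ((T - d) *\<^sub>R A2)" and "F2 = mat_exp (- ((T - d) *\<^sub>R A2))"
  note defs = E1_def F1_def E2_def F2_def
  define b k where "b = xm - xp" and "k = 1 / (ym - deriv h d)"
  have E1: "E1 *v x = y \<longleftrightarrow> x = F1 *v y" and E2: "E2 *v x = y \<longleftrightarrow> x = F2 *v y" for x y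
    unfolding defs
    by (intro invertible_matrix_vector_eq_iff mat_exp_minus_left mat_exp_minus_right)+
  let ?J = "sampled_jacobian A1 A2 C T d xm xp ym (deriv h d)"
  have J: "?J *v v = E2 *v (E1 *v v - (k * (C *v (E1 *v v)) $ 1) *\<^sub>R b)" for v
    unfolding sampled_jacobian_def
    by (simp add: E1_def E2_def b_def k_def columnvector_mult_vector
        matrix_vector_mult_diff_rdistrib flip: matrix_vector_mul_assoc scaleR_matrix_vector_assoc)
  \<comment> \<open>Here \<open>E1\<close> cancels \<open>F1\<close>, and moving \<open>E2\<close>
    across as \<open>F2\<close> leaves \<open>w\<close> minus the rank-one term equal to
    \<open>F2 *v (F1 *v w)\<close>.\<close>
  have "?J *v (F1 *v w) = F1 *v w \<longleftrightarrow> (mat 1 - F2 ** F1) *v w = (k * (C *v w) $ 1) *\<^sub>R b" for w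
    unfolding J E2 E1[THEN iffD2, OF refl]
    by (auto simp: algebra_simps simp flip: matrix_vector_mul_assoc)
  \<comment> \<open>Since \<open>F1\<close> is bijective with inverse \<open>E1\<close>, nonzero
    \<open>v\<close> and nonzero \<open>w = E1 *v v\<close> correspond.\<close>
  moreover have "(\<exists>v. v \<noteq> 0 \<and> ?J *v v = v) \<longleftrightarrow> (\<exists>w. w \<noteq> 0 \<and> ?J *v (F1 *v w) = F1 *v w)"
    using E1 by (metis matrix_vector_mult_0_right)
  ultimately have "saddle_node_criterion ?J \<longleftrightarrow>
      (\<exists>w. w \<noteq> 0 \<and> (mat 1 - F2 ** F1) *v w = (k * (C *v w) $ 1) *\<^sub>R b)"
    by (simp only: saddle_node_criterion_def mat_eigenvalue_def scaleR_one)
  also have "\<dots> \<longleftrightarrow> k * (C *v (matrix_inv (mat 1 - F2 ** F1) *v b)) $ 1 = 1"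
    using inv transversal by (intro rank_one_eigen_iff) (simp_all add: defs k_def)
  \<comment> \<open>Clearing the denominator \<open>ym - deriv h d\<close> of \<open>k\<close> is an
    equivalence because transversality makes it nonzero.\<close>
  also have "\<dots> \<longleftrightarrow> ym - (C *v (matrix_inv (mat 1 - F2 ** F1) *v b)) $ 1 = deriv h d"
    using transversal by (auto simp: k_def field_simps)
  finally show ?thesis unfolding defs b_def .
qed

end
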